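(* Let $G=\{a^r: r=0,\dots,2m-1\}$ be a cyclic group of order $n=2m$ with generator $a$. Let $W=\bigoplus_{r=0}^{n-1}W_{a^r}$ be a $G$-graded twisted real algebra (not necessarily associative or commutative) with symmetric associativity function $r$, i.e. $r(x,y,z)=r(y,x,z)$ for all $x,y,z\in G$. Let $B$ denote the standard basis for $W$, and let $A\subset\mathbb{R}^*$ be the group in which the structure constants take their values. Then $W$ is completely determined by the function $f:G\to A$, $f(a^r)=C_B(a^r,a)$. Thus, there are exactly $2|A|^{n-2}$ non-isomorphic $G$-graded twisted algebras over the reals (of this kind).
   Context: A $G$-graded twisted real algebra is an $\mathbb{R}$-algebra $W$ (not necessarily commutative or associative) with a grading $W=\bigoplus_{g\in G}W_g$, $W_xW_y\subset W_{xy}$, such that each $W_g$ is one-dimensional over $\mathbb{R}$, $w_xw_y\neq 0$ for all nonzero $w_x\in W_x$, $w_y\in W_y$, and $W$ has an identity element $1\in W_e$, where $e$ is the identity of $G$. For a basis $B=\{v_g:g\in G\}$ with $v_g\in W_g$ and $v_e=1$, the structure constant is the function $C_B:G\times G\to A\subset\mathbb{R}^*=\mathbb{R}\setminus\{0\}$ with $v_xv_y=C_B(x,y)v_{xy}$. The associativity function is $r(x,y,z)=C_B(y,z)C_B(xy,z)^{-1}C_B(x,yz)C_B(x,y)^{-1}$; it does not depend on the basis. Classification is considered under graded isomorphisms, i.e. unital $\mathbb{R}$-algebra isomorphisms mapping the component of degree $g$ into the component of degree $g$ for every $g\in G$. Standard basis ($n$ even): choose a nonzero $w_a\in W_a$,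 set inductively $w_{a^k}=w_a\cdot w_{a^{k-1}}$, and write $w_a\cdot w_{a^{n-1}}=\alpha\cdot 1$ with $\alpha\in\mathbb{R}^*$. Put $v_{a^0}=1$ and $v_{a^k}=\beta^kw_{a^k}$ for $0<k<n$, where $\beta\in\mathbb{R}$ satisfies $\beta^n=1/\alpha$ if $\alpha>0$ and $\beta^n=-1/\alpha$ if $\alpha<0$. In either case $B=\{1,v_a,\dots,v_{a^{n-1}}\}$ is called the standard basis for $W$. It satisfies $v_av_{a^{k-1}}=v_{a^k}$ for $1\le k\le n-1$, while $v_av_{a^{n-1}}=1$ if $\alpha>0$ and $v_av_{a^{n-1}}=-1$ if $\alpha<0$.
   Formalization: For n≥4 f alone does not determine W: changing the signs of both α and C_B(a^{n-1},a^k) (k odd) keeps f; so the kind of standard basis, C_B(a,a^{n-1})=±1, is taken as data with f. A is read as the group generated by the standard-basis constants of all such algebras. *)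

theory Defs
  imports "HOL-Analysis.Analysis" "HOL-Algebra.Generated_Groups"
begin

text \<open>
  The underlying real vector space of an algebra is the whole type \<open>'w\<close>; the record
  carries a multiplication, an identity element, and the family of homogeneous components.
\<close>

record ('g, 'w) graded_algebra =
  amult :: "'w \<Rightarrow> 'w \<Rightarrow> 'w"
  aone :: 'w
  comp :: "'g \<Rightarrow> 'w set"

definition direct_sum_decomposition :: "'g set \<Rightarrow> ('g \<Rightarrow> 'w::real_vector set) \<Rightarrow> bool" where
  "direct_sum_decomposition I V \<longleftrightarrow>
     (\<forall>i\<in>I. subspace (V i)) \<and>
     (\<forall>w. \<exists>!u. (\<forall>i\<in>I. u i \<in> V i) \<and> (\<forall>i. i \<notin> I \<longrightarrow> u i = 0) \<and>
               finite {i. u i \<noteq> 0} \<and> w = (\<Sum>i | u i \<noteq> 0. u i))"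

definition graded_twisted_algebra ::
    "('g, 'm) monoid_scheme \<Rightarrow> ('g, 'w::real_vector) graded_algebra \<Rightarrow> bool" where
  "graded_twisted_algebra G W \<longleftrightarrow>
     bilinear (amult W) \<and>
     (\<forall>w. amult W (aone W) w = w \<and> amult W w (aone W) = w) \<and>
     aone W \<in> comp W \<one>\<^bsub>G\<^esub> \<and>
     direct_sum_decomposition (carrier G) (comp W) \<and>
     (\<forall>g\<in>carrier G. dim (comp W g) = 1) \<and>
     (\<forall>x\<in>carrier G. \<forall>y\<in>carrier G. \<forall>u\<in>comp W x. \<forall>v\<in>comp W y.
        amult W u v \<in> comp W (x \<otimes>\<^bsub>G\<^esub> y)) \<and>
     (\<forall>x\<in>carrier G. \<forall>y\<in>carrier G. \<forall>u\<in>comp W x. \<forall>v\<in>comp W y.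
        u \<noteq> 0 \<longrightarrow> v \<noteq> 0 \<longrightarrow> amult W u v \<noteq> 0)"

definition graded_basis ::
    "('g, 'm) monoid_scheme \<Rightarrow> ('g, 'w::real_vector) graded_algebra \<Rightarrow> ('g \<Rightarrow> 'w) \<Rightarrow> bool" where
  "graded_basis G W v \<longleftrightarrow>
     inj_on v (carrier G) \<and> independent (v ` carrier G) \<and> span (v ` carrier G) = UNIV \<and>
     (\<forall>g\<in>carrier G. v g \<in> comp W g) \<and> v \<one>\<^bsub>G\<^esub> = aone W"

definition structure_constant ::
    "('g, 'm) monoid_scheme \<Rightarrow> ('g, 'w::real_vector) graded_algebra \<Rightarrow> ('g \<Rightarrow> 'w) \<Rightarrow>
       'g \<Rightarrow> 'g \<Rightarrow> real" where
  "structure_constant G W v x y = (THE c. amult W (v x) (v y) = c *\<^sub>R v (x \<otimes>\<^bsub>G\<^esub> y))"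

definition associativity_function ::
    "('g, 'm) monoid_scheme \<Rightarrow> ('g, 'w::real_vector) graded_algebra \<Rightarrow> ('g \<Rightarrow> 'w) \<Rightarrow>
       'g \<Rightarrow> 'g \<Rightarrow> 'g \<Rightarrow> real" where
  "associativity_function G W v x y z =
     structure_constant G W v y z * inverse (structure_constant G W v (x \<otimes>\<^bsub>G\<^esub> y) z) *
     structure_constant G W v x (y \<otimes>\<^bsub>G\<^esub> z) * inverse (structure_constant G W v x y)"

text \<open>
  The associativity function does not depend on the graded basis, so quantifying over all
  of them is the same as picking one.
\<close>

definition symmetric_associativity ::
    "('g, 'm) monoid_scheme \<Rightarrow> ('g, 'w::real_vector) graded_algebra \<Rightarrow> bool" where
  "symmetric_associativity G W \<longleftrightarrow>
     (\<forall>v. graded_basis G W v \<longrightarrow>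
        (\<forall>x\<in>carrier G. \<forall>y\<in>carrier G. \<forall>z\<in>carrier G.
           associativity_function G W v x y z = associativity_function G W v y x z))"

definition graded_isomorphic ::
    "('g, 'm) monoid_scheme \<Rightarrow> ('g, 'w::real_vector) graded_algebra \<Rightarrow>
       ('g, 'v::real_vector) graded_algebra \<Rightarrow> bool" where
  "graded_isomorphic G W W' \<longleftrightarrow>
     (\<exists>\<phi>. linear \<phi> \<and> bij \<phi> \<and> \<phi> (aone W) = aone W' \<and>
          (\<forall>u v. \<phi> (amult W u v) = amult W' (\<phi> u) (\<phi> v)) \<and>
          (\<forall>g\<in>carrier G. \<phi> ` comp W g \<subseteq> comp W' g))"

definition graded_iso_rel ::
    "('g, 'm) monoid_scheme \<Rightarrow> ('g, 'w::real_vector) graded_algebra set \<Rightarrow>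
       ('g, 'w) graded_algebra rel" where
  "graded_iso_rel G \<A> = {(V, V'). V \<in> \<A> \<and> V' \<in> \<A> \<and> graded_isomorphic G V V'}"

text \<open>\<open>left_power W w k\<close> is \<open>w \<cdot> (w \<cdot> (\<dots> \<cdot> w))\<close> with \<open>k\<close> factors.\<close>

primrec left_power :: "('g, 'w) graded_algebra \<Rightarrow> 'w \<Rightarrow> nat \<Rightarrow> 'w" where
  "left_power W w 0 = aone W"
| "left_power W w (Suc k) = amult W w (left_power W w k)"

text \<open>For \<open>G\<close> cyclic of even order with generator \<open>a\<close>.\<close>

definition standard_basis ::
    "('g, 'm) monoid_scheme \<Rightarrow> 'g \<Rightarrow> ('g, 'w::real_vector) graded_algebra \<Rightarrow>
       ('g \<Rightarrow> 'w) \<Rightarrow> bool" where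
  "standard_basis G a W v \<longleftrightarrow>
     (\<exists>w \<alpha> \<beta>. w \<in> comp W a \<and> w \<noteq> 0 \<and> \<alpha> \<noteq> 0 \<and>
        amult W w (left_power W w (order G - 1)) = \<alpha> *\<^sub>R aone W \<and>
        \<beta> ^ order G = (if \<alpha> > 0 then 1 / \<alpha> else - (1 / \<alpha>)) \<and>
        v \<one>\<^bsub>G\<^esub> = aone W \<and>
        (\<forall>k. 0 < k \<and> k < order G \<longrightarrow> v (a [^]\<^bsub>G\<^esub> k) = \<beta> ^ k *\<^sub>R left_power W w k))"

definition real_units :: "real monoid" where
  "real_units = \<lparr>carrier = UNIV - {0}, monoid.mult = (*), one = 1\<rparr>"

text \<open>
  The subgroup of \<open>\<real>\<^sup>*\<close> in which the structure constants of the algebras in \<open>\<A>\<close>,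
  taken with respect to standard bases, have their values.
\<close>

definition structure_constant_group ::
    "('g, 'm) monoid_scheme \<Rightarrow> 'g \<Rightarrow> ('g, 'w::real_vector) graded_algebra set \<Rightarrow> real set" where
  "structure_constant_group G a \<A> =
     generate real_units {structure_constant G V v x y | V v x y.
       V \<in> \<A> \<and> standard_basis G a V v \<and> x \<in> carrier G \<and> y \<in> carrier G}"

end

theory Submission
  imports Defs
begin

text \<open>
  Write \<open>L\<^sub>x\<close> for left multiplication by the basis vector of degree \<open>x\<close>. Symmetry of the
  associativity function says that \<open>L\<^sub>x L\<^sub>y\<close> and \<open>L\<^sub>y L\<^sub>x\<close> agree up to the scalar
  \<open>C(x,y) / C(y,x)\<close>. Commuting \<open>L\<^sub>x\<close> past the powers of \<open>L\<^sub>a\<close>, which in a standard basis moves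
  \<open>v\<^bsub>a^k\<^esub>\<close> to \<open>v\<^bsub>a^(k+1)\<^esub>\<close> and satisfies \<open>L\<^sub>a\<^sup>n = s\<close> with a sign \<open>s\<close>, gives
  \<open>C(a\<^sup>i, a\<^sup>k) = e\<^sub>i\<^sup>k s\<^bsup>(i+k) div n\<^esup>\<close> for signs \<open>e\<^sub>i\<close> with \<open>e\<^sub>0 = e\<^sub>1 = 1\<close>, where \<open>e\<^sub>i\<close> is
  \<open>C(a\<^sup>i, a)\<close> up to a factor \<open>s\<close> when \<open>i = n - 1\<close>. So \<open>A = {1, -1}\<close>. Since \<open>n\<close> is even, every
  choice of \<open>s\<close> and of \<open>e\<^sub>2, \<dots>, e\<^bsub>n-1\<^esub>\<close> gives a symmetric associativity function, and two
  standard bases of one algebra differ by \<open>v\<^bsub>a^k\<^esub> \<mapsto> \<mu>\<^sup>k v\<^bsub>a^k\<^esub>\<close> with \<open>\<mu> = \<plusminus>1\<close>, which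
  leaves the structure constants unchanged.
\<close>

section \<open>Graded twisted algebras and graded bases\<close>

lemma subspace_dim_1_multiple:
  fixes S :: "'a::real_vector set"
  assumes "subspace S" "dim S = 1" "v \<in> S" "v \<noteq> 0" "w \<in> S"
  shows "\<exists>c. w = c *\<^sub>R v"
proof -
  obtain b where b: "b \<subseteq> S" "independent b" "S \<subseteq> span b" "card b = dim S"
    by (rule basis_exists)
  then obtain x where x: "b = {x}"
    using assms(2) by (metis card_1_singletonE)
  obtain k l where k: "v = k *\<^sub>R x" and l: "w = l *\<^sub>R x"
    using b(3) assms(3,5) unfolding x span_singleton by blast
  have "k \<noteq> 0" using k assms(4) by auto
  then have "w = (l / k) *\<^sub>R v" by (simp add: k l)
  then show ?thesis ..
qed

lemma linear_eq_id:
  fixes f :: "'a::real_vector \<Rightarrow> 'a"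
  assumes "linear f" "span S = UNIV" "\<And>x. x \<in> S \<Longrightarrow> f x = x"
  shows "f u = u"
proof -
  have "f u = id u"
    by (rule linear_eq_on[where f = f and g = id and B = S])
      (use assms linear_id in \<open>simp_all add: id_def\<close>)
  then show ?thesis by simp
qed

lemma graded_twisted_algebraD:
  assumes "graded_twisted_algebra G W"
  shows "bilinear (amult W)" "amult W (aone W) w = w" "amult W w (aone W) = w"
    "aone W \<in> comp W \<one>\<^bsub>G\<^esub>" "direct_sum_decomposition (carrier G) (comp W)"
    "g \<in> carrier G \<Longrightarrow> dim (comp W g) = 1"
    "g \<in> carrier G \<Longrightarrow> subspace (comp W g)"
    "x \<in> carrier G \<Longrightarrow> y \<in> carrier G \<Longrightarrow> u \<in> comp W x \<Longrightarrow> v \<in> comp W y \<Longrightarrow>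
       amult W u v \<in> comp W (x \<otimes>\<^bsub>G\<^esub> y)"
    "x \<in> carrier G \<Longrightarrow> y \<in> carrier G \<Longrightarrow> u \<in> comp W x \<Longrightarrow> v \<in> comp W y \<Longrightarrow>
       u \<noteq> 0 \<Longrightarrow> v \<noteq> 0 \<Longrightarrow> amult W u v \<noteq> 0"
  using assms by (simp_all add: graded_twisted_algebra_def direct_sum_decomposition_def)

lemma comp_multiple:
  assumes "graded_twisted_algebra G W" "g \<in> carrier G" "v \<in> comp W g" "v \<noteq> 0" "w \<in> comp W g"
  shows "\<exists>c. w = c *\<^sub>R v"
  using subspace_dim_1_multiple graded_twisted_algebraD(6,7)[OF assms(1,2)] assms(3-5) by blast

lemma comp_nonzero:
  fixes W :: "('g, 'w::real_vector) graded_algebra"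
  assumes "graded_twisted_algebra G W" "g \<in> carrier G"
  shows "\<exists>v\<in>comp W g. v \<noteq> 0"
proof -
  obtain b where b: "b \<subseteq> comp W g" "independent b" "comp W g \<subseteq> span b"
    "card b = dim (comp W g)"
    by (rule basis_exists)
  then obtain x where "b = {x}"
    using card_1_singletonE[of b] graded_twisted_algebraD(6)[OF assms] by metis
  then show ?thesis using b(1,2) by auto
qed

lemma aone_nonzero:
  fixes W :: "('g, 'w::real_vector) graded_algebra"
  assumes "graded_twisted_algebra G W" "g \<in> carrier G"
  shows "aone W \<noteq> 0"
proof
  assume "aone W = 0"
  then have "w = 0" for w :: 'w
    using graded_twisted_algebraD(2)[OF assms(1), of w]
      bilinear_lzero[OF graded_twisted_algebraD(1)[OF assms(1)]] by simp
  then show False using comp_nonzero[OF assms] by blast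
qed

text \<open>The decomposition is unique among functions on the whole index type that vanish off
  \<open>I\<close>, so \<open>p\<close> and \<open>q\<close> are first extended by zero and then
  compared.\<close>

lemma direct_sum_decomposition_unique:
  assumes "direct_sum_decomposition I V" "finite I"
    and "\<And>i. i \<in> I \<Longrightarrow> p i \<in> V i" "\<And>i. i \<in> I \<Longrightarrow> q i \<in> V i"
    and "(\<Sum>i\<in>I. p i) = (\<Sum>i\<in>I. q i)" "j \<in> I"
  shows "p j = q j"
proof -
  define P where "P w u \<longleftrightarrow> (\<forall>i\<in>I. u i \<in> V i) \<and> (\<forall>i. i \<notin> I \<longrightarrow> u i = 0) \<and>
               finite {i. u i \<noteq> 0} \<and> w = (\<Sum>i | u i \<noteq> 0. u i)" for w u
  let ?u = "\<lambda>f i. if i \<in> I then f i else 0"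
  have P: "P (\<Sum>i\<in>I. f i) (?u f)" if "\<And>i. i \<in> I \<Longrightarrow> f i \<in> V i" for f
    unfolding P_def
  proof (intro conjI)
    have sub: "{i. ?u f i \<noteq> 0} \<subseteq> I" by auto
    then show "finite {i. ?u f i \<noteq> 0}" using assms(2) finite_subset by blast
    have "(\<Sum>i | ?u f i \<noteq> 0. ?u f i) = (\<Sum>i\<in>I. ?u f i)"
      by (rule sum.mono_neutral_left[OF assms(2) sub]) auto
    then show "(\<Sum>i\<in>I. f i) = (\<Sum>i | ?u f i \<noteq> 0. ?u f i)" by simp
  qed (use that in auto)
  have "\<exists>!u. P (\<Sum>i\<in>I. p i) u"
    using assms(1) unfolding direct_sum_decomposition_def P_def by blast
  moreover have "P (\<Sum>i\<in>I. p i) (?u p)" by (rule P[OF assms(3)])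
  moreover have "P (\<Sum>i\<in>I. p i) (?u q)" unfolding assms(5) by (rule P[OF assms(4)])
  ultimately have "?u p = ?u q" by blast
  from fun_cong[OF this, of j] show ?thesis using assms(6) by simp
qed

text \<open>Since the components are lines, any nonzero homogeneous vectors give a basis: uniqueness
  of the decomposition yields injectivity and independence, its existence yields spanning.\<close>

lemma graded_basisI:
  fixes W :: "('g, 'w::real_vector) graded_algebra"
  assumes W: "graded_twisted_algebra G W" and fin: "finite (carrier G)"
    and v: "\<And>g. g \<in> carrier G \<Longrightarrow> v g \<in> comp W g" "\<And>g. g \<in> carrier G \<Longrightarrow> v g \<noteq> 0"
    and one: "v \<one>\<^bsub>G\<^esub> = aone W"
  shows "graded_basis G W v"
proof -
  note ds = graded_twisted_algebraD(5)[OF W]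
  have zero: "0 \<in> comp W g" if "g \<in> carrier G" for g
    using graded_twisted_algebraD(7)[OF W that] by (simp add: subspace_0)
  have inj: "inj_on v (carrier G)"
  proof (rule inj_onI, rule ccontr)
    fix g h assume gh: "g \<in> carrier G" "h \<in> carrier G" "v g = v h" "g \<noteq> h"
    \<comment> \<open>\<open>?\<delta> k\<close> is the family concentrated in degree
      \<open>k\<close>. If \<open>v g = v h\<close>, the families for \<open>g\<close> and
      \<open>h\<close> decompose the same vector in different degrees.\<close>
    let ?\<delta> = "\<lambda>k i. if i = k then v k else 0"
    have "?\<delta> k i \<in> comp W i" if "i \<in> carrier G" for k i
      using v(1) zero that by auto
    moreover have "(\<Sum>i\<in>carrier G. ?\<delta> g i) = (\<Sum>i\<in>carrier G. ?\<delta> h i)"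
      using gh(1-3) fin by simp
    ultimately have "?\<delta> g g = ?\<delta> h g"
      by (intro direct_sum_decomposition_unique[OF ds fin _ _ _ gh(1), of "?\<delta> g" "?\<delta> h"])
    then show False using gh v(2) by auto
  qed
  have indep: "independent (v ` carrier G)"
  proof
    assume "dependent (v ` carrier G)"
    then obtain u where u: "\<exists>x\<in>v ` carrier G. u x \<noteq> 0" "(\<Sum>x\<in>v ` carrier G. u x *\<^sub>R x) = 0"
      unfolding dependent_finite[OF finite_imageI[OF fin]] by (elim exE conjE)
    have "(\<Sum>g\<in>carrier G. u (v g) *\<^sub>R v g) = (\<Sum>g\<in>carrier G. 0)"
      using u(2) by (simp add: sum.reindex[OF inj])
    then have "u (v g) *\<^sub>R v g = 0" if "g \<in> carrier G" for g
      by (intro direct_sum_decomposition_unique[OF ds fin _ _ _ that,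
            of "\<lambda>g. u (v g) *\<^sub>R v g" "\<lambda>_. 0"] subspace_scale graded_twisted_algebraD(7)[OF W] v(1) zero)
    then show False using u(1) v(2) by force
  qed
  have "w \<in> span (v ` carrier G)" for w
  proof -
    obtain u where u: "\<forall>i\<in>carrier G. u i \<in> comp W i" "\<forall>i. i \<notin> carrier G \<longrightarrow> u i = 0"
      "w = (\<Sum>i | u i \<noteq> 0. u i)"
      using ds unfolding direct_sum_decomposition_def by blast
    have "u i \<in> span (v ` carrier G)" if "u i \<noteq> 0" for i
    proof -
      have i: "i \<in> carrier G" using u(2) that by blast
      then obtain c where "u i = c *\<^sub>R v i"
        using comp_multiple[OF W i v(1)[OF i] v(2)[OF i]] u(1) by blast
      then show ?thesis using i by (simp add: span_base span_scale)
    qed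
    then show ?thesis unfolding u(3) by (auto intro: span_sum)
  qed
  then show ?thesis
    unfolding graded_basis_def using inj indep v(1) one by auto
qed

lemma graded_basisD:
  assumes "graded_basis G W v"
  shows "inj_on v (carrier G)" "independent (v ` carrier G)" "span (v ` carrier G) = UNIV"
    "g \<in> carrier G \<Longrightarrow> v g \<in> comp W g" "v \<one>\<^bsub>G\<^esub> = aone W" "g \<in> carrier G \<Longrightarrow> v g \<noteq> 0"
proof -
  show "g \<in> carrier G \<Longrightarrow> v g \<noteq> 0"
    using assms dependent_zero unfolding graded_basis_def by (metis imageI)
qed (use assms in \<open>auto simp: graded_basis_def\<close>)

lemma structure_constant_eqI:
  assumes "amult W (v x) (v y) = c *\<^sub>R v (x \<otimes>\<^bsub>G\<^esub> y)" "v (x \<otimes>\<^bsub>G\<^esub> y) \<noteq> 0"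
  shows "structure_constant G W v x y = c"
  unfolding structure_constant_def by (rule the_equality) (use assms in auto)

section \<open>Structure constants and change of graded basis\<close>

context group
begin

lemma amult_graded_basis:
  assumes W: "graded_twisted_algebra G W" and v: "graded_basis G W v"
    and "x \<in> carrier G" "y \<in> carrier G"
  shows "amult W (v x) (v y) = structure_constant G W v x y *\<^sub>R v (x \<otimes> y)"
    and "structure_constant G W v x y \<noteq> 0"
proof -
  have xy: "x \<otimes> y \<in> carrier G" using assms by simp
  have "amult W (v x) (v y) \<in> comp W (x \<otimes> y)"
    using graded_twisted_algebraD(8)[OF W] graded_basisD(4)[OF v] assms by blast
  then obtain c where c: "amult W (v x) (v y) = c *\<^sub>R v (x \<otimes> y)"
    using comp_multiple[OF W xy] graded_basisD(4,6)[OF v xy] by blast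
  then have s: "structure_constant G W v x y = c"
    by (rule structure_constant_eqI) (rule graded_basisD(6)[OF v xy])
  show "amult W (v x) (v y) = structure_constant G W v x y *\<^sub>R v (x \<otimes> y)"
    using c s by simp
  have "amult W (v x) (v y) \<noteq> 0"
    using graded_twisted_algebraD(9)[OF W] graded_basisD(4,6)[OF v] assms by blast
  then show "structure_constant G W v x y \<noteq> 0" using c s by auto
qed

lemma structure_constant_one:
  assumes W: "graded_twisted_algebra G W" and v: "graded_basis G W v" and x: "x \<in> carrier G"
  shows "structure_constant G W v x \<one> = 1" "structure_constant G W v \<one> x = 1"
  using x graded_basisD(5,6)[OF v] graded_twisted_algebraD(2,3)[OF W]
  by (auto intro!: structure_constant_eqI)

text \<open>Rescaling the basis multiplies the structure constants by the coboundary of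
  \<open>l\<close>.\<close>

lemma structure_constant_rescale:
  assumes W: "graded_twisted_algebra G W" and v: "graded_basis G W v" and v': "graded_basis G W v'"
    and l: "\<And>g. g \<in> carrier G \<Longrightarrow> v' g = l g *\<^sub>R v g"
    and xy: "x \<in> carrier G" "y \<in> carrier G"
  shows "structure_constant G W v' x y = l x * l y / l (x \<otimes> y) * structure_constant G W v x y"
proof (rule structure_constant_eqI)
  have c: "x \<otimes> y \<in> carrier G" using xy by simp
  show nz: "v' (x \<otimes> y) \<noteq> 0" by (rule graded_basisD(6)[OF v' c])
  then have "l (x \<otimes> y) \<noteq> 0" using l[OF c] by auto
  then show "amult W (v' x) (v' y) =
    (l x * l y / l (x \<otimes> y) * structure_constant G W v x y) *\<^sub>R v' (x \<otimes> y)"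
    using graded_twisted_algebraD(1)[OF W] amult_graded_basis(1)[OF W v xy]
    by (simp add: l xy c bilinear_lmul bilinear_rmul)
qed

lemma graded_basis_rescaling:
  assumes W: "graded_twisted_algebra G W" and v: "graded_basis G W v" and v': "graded_basis G W v'"
  shows "\<exists>l. \<forall>g\<in>carrier G. v' g = l g *\<^sub>R v g \<and> l g \<noteq> 0"
proof (rule bchoice)
  show "\<forall>g\<in>carrier G. \<exists>c. v' g = c *\<^sub>R v g \<and> c \<noteq> 0"
  proof
    fix g assume that: "g \<in> carrier G"
    show "\<exists>c. v' g = c *\<^sub>R v g \<and> c \<noteq> 0"
      using comp_multiple[OF W that graded_basisD(4,6)[OF v that] graded_basisD(4)[OF v' that]]
        graded_basisD(6)[OF v' that] by auto
  qed
qed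

text \<open>Two graded bases differ by a rescaling \<open>l\<close>, and all values of
  \<open>l\<close> cancel because the coboundary of a coboundary is trivial. Associativity of the
  group identifies the two occurrences of \<open>l\<close> at the triple product.\<close>

lemma associativity_function_basis_independent:
  assumes W: "graded_twisted_algebra G W" and v: "graded_basis G W v" and v': "graded_basis G W v'"
    and xyz: "x \<in> carrier G" "y \<in> carrier G" "z \<in> carrier G"
  shows "associativity_function G W v' x y z = associativity_function G W v x y z"
proof -
  obtain l where l: "\<And>g. g \<in> carrier G \<Longrightarrow> v' g = l g *\<^sub>R v g" "\<And>g. g \<in> carrier G \<Longrightarrow> l g \<noteq> 0"
    using graded_basis_rescaling[OF W v v'] by blast
  show ?thesis
    unfolding associativity_function_def
    using xyz amult_graded_basis(2)[OF W v]
    by (simp add: structure_constant_rescale[OF W v v' l(1)] l(2) field_simps m_assoc)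
qed

lemma symmetric_associativityI:
  assumes W: "graded_twisted_algebra G W" and v: "graded_basis G W v"
    and "\<And>x y z. x \<in> carrier G \<Longrightarrow> y \<in> carrier G \<Longrightarrow> z \<in> carrier G \<Longrightarrow>
      associativity_function G W v x y z = associativity_function G W v y x z"
  shows "symmetric_associativity G W"
  unfolding symmetric_associativity_def
  using assms(3) associativity_function_basis_independent[OF W v] by auto

section \<open>Algebras compared by, and built from, their structure constants\<close>

text \<open>The isomorphism extends \<open>v g \<mapsto> v' g\<close> linearly, with inverse built
  the same way in the other direction. By bilinearity, multiplicativity need only be checked on
  pairs of basis vectors.\<close>

lemma graded_isomorphicI_structure_constant:
  fixes W :: "('a, 'w::real_vector) graded_algebra" and W' :: "('a, 'v::real_vector) graded_algebra"
  assumes W: "graded_twisted_algebra G W" and v: "graded_basis G W v"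
    and W': "graded_twisted_algebra G W'" and v': "graded_basis G W' v'"
    and eq: "\<And>x y. x \<in> carrier G \<Longrightarrow> y \<in> carrier G \<Longrightarrow>
      structure_constant G W v x y = structure_constant G W' v' x y"
  shows "graded_isomorphic G W W'"
proof -
  obtain \<phi> where \<phi>: "linear \<phi>" "\<forall>x\<in>v ` carrier G. \<phi> x = (v' \<circ> inv_into (carrier G) v) x"
    using linear_independent_extend[OF graded_basisD(2)[OF v]] by blast
  obtain \<psi> where \<psi>: "linear \<psi>" "\<forall>x\<in>v' ` carrier G. \<psi> x = (v \<circ> inv_into (carrier G) v') x"
    using linear_independent_extend[OF graded_basisD(2)[OF v']] by blast
  have \<phi>v: "\<phi> (v g) = v' g" if "g \<in> carrier G" for g
    using \<phi>(2) that graded_basisD(1)[OF v] by simp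
  have \<psi>v: "\<psi> (v' g) = v g" if "g \<in> carrier G" for g
    using \<psi>(2) that graded_basisD(1)[OF v'] by simp
  have "(\<psi> \<circ> \<phi>) u = u" for u
    by (rule linear_eq_id[OF linear_compose[OF \<phi>(1) \<psi>(1)] graded_basisD(3)[OF v]])
       (auto simp: \<phi>v \<psi>v)
  moreover have "(\<phi> \<circ> \<psi>) u = u" for u
    by (rule linear_eq_id[OF linear_compose[OF \<psi>(1) \<phi>(1)] graded_basisD(3)[OF v']])
       (auto simp: \<phi>v \<psi>v)
  ultimately have "bij \<phi>"
    by (intro o_bij[of \<psi>]) auto
  moreover have "\<phi> (amult W x y) = amult W' (\<phi> x) (\<phi> y)" for x y
  proof (rule bilinear_eq[where S = UNIV and T = UNIV and B = "v ` carrier G" and C = "v ` carrier G"])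
    show "bilinear (\<lambda>x y. \<phi> (amult W x y))" "bilinear (\<lambda>x y. amult W' (\<phi> x) (\<phi> y))"
      using graded_twisted_algebraD(1)[OF W] graded_twisted_algebraD(1)[OF W'] \<phi>(1)
      unfolding bilinear_def by (auto simp: linear_iff)
    fix x y assume "x \<in> v ` carrier G" "y \<in> v ` carrier G"
    then obtain g h where gh: "g \<in> carrier G" "h \<in> carrier G" "x = v g" "y = v h" by blast
    show "\<phi> (amult W x y) = amult W' (\<phi> x) (\<phi> y)"
      using gh \<phi>(1) by (simp add: amult_graded_basis(1)[OF W v] amult_graded_basis(1)[OF W' v']
          linear_scale \<phi>v eq)
  qed (use graded_basisD(3)[OF v] in auto)
  moreover have "\<phi> (aone W) = aone W'"
    using \<phi>v[OF one_closed] graded_basisD(5)[OF v] graded_basisD(5)[OF v'] by simp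
  moreover have "\<phi> ` comp W g \<subseteq> comp W' g" if g: "g \<in> carrier G" for g
  proof
    fix u assume "u \<in> \<phi> ` comp W g"
    then obtain c where "u = \<phi> (c *\<^sub>R v g)"
      using comp_multiple[OF W g graded_basisD(4,6)[OF v g]] by blast
    then have "u = c *\<^sub>R v' g" using \<phi>(1) \<phi>v[OF g] by (simp add: linear_scale)
    then show "u \<in> comp W' g"
      using graded_twisted_algebraD(7)[OF W' g] graded_basisD(4)[OF v' g] by (simp add: subspace_scale)
  qed
  ultimately show ?thesis
    unfolding graded_isomorphic_def using \<phi>(1) by blast
qed

text \<open>The algebra \<open>W\<close> supplies the vector space, the grading and the identity;
  only the product is replaced. Since the product need not be associative, any nonvanishing
  \<open>c\<close> normalised at the identity is admissible.\<close>

lemma twisted_algebra_exists: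
  fixes W :: "('a, 'w::real_vector) graded_algebra"
  assumes fin: "finite (carrier G)"
    and W: "graded_twisted_algebra G W" and b: "graded_basis G W b"
    and c: "\<And>x y. x \<in> carrier G \<Longrightarrow> y \<in> carrier G \<Longrightarrow> c x y \<noteq> 0"
      "\<And>x. x \<in> carrier G \<Longrightarrow> c x \<one> = 1" "\<And>x. x \<in> carrier G \<Longrightarrow> c \<one> x = 1"
  obtains V :: "('a, 'w) graded_algebra" where "graded_twisted_algebra G V" "graded_basis G V b"
    "\<And>x y. x \<in> carrier G \<Longrightarrow> y \<in> carrier G \<Longrightarrow> structure_constant G V b x y = c x y"
proof -
  let ?B = "b ` carrier G"
  \<comment> \<open>\<open>R u x\<close> is the coordinate of \<open>u\<close> along
    \<open>b x\<close>, so \<open>mult\<close> below is the bilinear extension of the prescribed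
    products.\<close>
  define R where "R u x = representation ?B u (b x)" for u x
  define mult where
    "mult u v = (\<Sum>x\<in>carrier G. \<Sum>y\<in>carrier G. (R u x * R v y * c x y) *\<^sub>R b (x \<otimes> y))" for u v
  define V where "V = \<lparr>amult = mult, aone = aone W, comp = comp W\<rparr>"
  note ind = graded_basisD(2)[OF b] and sp = graded_basisD(3)[OF b] and inj = graded_basisD(1)[OF b]
  have R_add: "R (u + v) x = R u x + R v x" and R_scale: "R (k *\<^sub>R u) x = k * R u x" for u v x k
    using representation_add[OF ind] representation_scale[OF ind] by (simp_all add: R_def sp)
  have R_basis: "R (b x) y = (if y = x then 1 else 0)" if "x \<in> carrier G" "y \<in> carrier G" for x y
    using representation_basis[OF ind, of "b x"] that inj by (auto simp: R_def inj_on_eq_iff)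
  have bil: "bilinear mult"
    unfolding bilinear_def mult_def linear_iff
    by (auto simp: R_add R_scale algebra_simps sum.distrib scaleR_sum_right)
  have mult_b: "mult (b x) (b y) = c x y *\<^sub>R b (x \<otimes> y)" if "x \<in> carrier G" "y \<in> carrier G" for x y
  proof -
    have "mult (b x) (b y) = (\<Sum>x'\<in>carrier G. \<Sum>y'\<in>carrier G.
        if y' = y then (if x' = x then c x y *\<^sub>R b (x \<otimes> y) else 0) else 0)"
      unfolding mult_def by (intro sum.cong refl) (simp add: R_basis that)
    also have "\<dots> = c x y *\<^sub>R b (x \<otimes> y)"
      using fin that by simp
    finally show ?thesis .
  qed
  have one_l: "mult (aone W) u = u" for u
    by (rule linear_eq_id[OF _ sp])
       (use bil in \<open>auto simp: bilinear_def graded_basisD(5)[OF b, symmetric] mult_b c\<close>)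
  have one_r: "mult u (aone W) = u" for u
    by (rule linear_eq_id[of "\<lambda>u. mult u (aone W)", OF _ sp])
       (use bil in \<open>auto simp: bilinear_def graded_basisD(5)[OF b, symmetric] mult_b c\<close>)
  \<comment> \<open>An explicit scalar for homogeneous products serves both compatibility with the
    grading and the nonvanishing condition.\<close>
  have prod: "\<exists>k. mult u v = k *\<^sub>R b (x \<otimes> y) \<and> (u \<noteq> 0 \<longrightarrow> v \<noteq> 0 \<longrightarrow> k \<noteq> 0)"
    if xy: "x \<in> carrier G" "y \<in> carrier G" and uv: "u \<in> comp W x" "v \<in> comp W y" for x y u v
  proof -
    obtain k l where "u = k *\<^sub>R b x" "v = l *\<^sub>R b y"
      using comp_multiple[OF W xy(1) graded_basisD(4,6)[OF b xy(1)] uv(1)]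
        comp_multiple[OF W xy(2) graded_basisD(4,6)[OF b xy(2)] uv(2)] by blast
    then show ?thesis
      using bil c(1)[OF xy] mult_b[OF xy]
      by (intro exI[of _ "k * l * c x y"]) (simp add: bilinear_lmul bilinear_rmul)
  qed
  have closed: "mult u v \<in> comp W (x \<otimes> y)"
    if "x \<in> carrier G" "y \<in> carrier G" "u \<in> comp W x" "v \<in> comp W y" for x y u v
    using prod[OF that] graded_basisD(4)[OF b m_closed[OF that(1,2)]]
      graded_twisted_algebraD(7)[OF W m_closed[OF that(1,2)]] by (auto simp: subspace_scale)
  have nonzero: "mult u v \<noteq> 0"
    if "x \<in> carrier G" "y \<in> carrier G" "u \<in> comp W x" "v \<in> comp W y" "u \<noteq> 0" "v \<noteq> 0" for x y u v
    using prod[OF that(1-4)] that(5,6) graded_basisD(6)[OF b m_closed[OF that(1,2)]] by auto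
  have V: "graded_twisted_algebra G V"
    unfolding graded_twisted_algebra_def V_def
    using bil one_l one_r closed nonzero graded_twisted_algebraD(4,5,6)[OF W] by auto
  moreover have bV: "graded_basis G V b"
    using b by (simp add: graded_basis_def V_def)
  moreover have "structure_constant G V b x y = c x y" if "x \<in> carrier G" "y \<in> carrier G" for x y
    by (rule structure_constant_eqI)
       (use mult_b that graded_basisD(6)[OF b m_closed[OF that]] in \<open>auto simp: V_def\<close>)
  ultimately show ?thesis by (rule that)
qed

end

section \<open>Cyclic groups of even order\<close>

text \<open>A sign has trivial \<open>n\<close>-th power because \<open>n\<close> is even, so
  exponents of signs depend only on the group element and not on the representative.\<close>

lemma sign_power_mod:
  fixes x :: real
  assumes "x \<in> {1, -1}" "even n"
  shows "x ^ (k mod n) = x ^ k"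
proof -
  have "x ^ k = (x ^ n) ^ (k div n) * x ^ (k mod n)"
    by (simp flip: power_mult power_add)
  moreover have "x ^ n = 1" using assms by auto
  ultimately show ?thesis by simp
qed

lemma sign_power:
  fixes x :: real
  assumes "x \<in> {1, -1}"
  shows "x ^ k \<in> {1, -1}"
  using assms by (cases "even k") auto

text \<open>Carries are additive: reducing \<open>k\<close> first and then adding \<open>i\<close>
  passes as many multiples of \<open>n\<close> in total as forming \<open>i + k\<close>
  directly.\<close>

lemma div_add_mod_div: "(k::nat) div n + (i + k mod n) div n = (i + k) div n"
proof (cases "n = 0")
  case False
  have "i + k = (i + k mod n) + n * (k div n)" by simp
  then show ?thesis using False
    by (metis add.commute div_mult_self2)
qed simp

text \<open>
  In a standard basis, \<open>wrap n s k\<close> is the structure constant of the pair \<open>(a, a\<^sup>k)\<close>: the sign \<open>s\<close>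
  enters each time the exponent passes a multiple of \<open>n\<close>.
\<close>

definition wrap :: "nat \<Rightarrow> real \<Rightarrow> nat \<Rightarrow> real" where
  "wrap n s k = (if Suc k mod n = 0 then s else 1)"

lemma wrap_sign: "s \<in> {1, -1} \<Longrightarrow> wrap n s k \<in> {1, -1}"
  by (auto simp: wrap_def)

lemma wrap_square: "s \<in> {1, -1} \<Longrightarrow> wrap n s k * wrap n s k = 1"
  by (auto simp: wrap_def)

text \<open>\<open>wrap\<close> is the ratio of consecutive powers \<open>s ^ (k div n)\<close>,
  which makes products of its values telescope.\<close>

lemma wrap_power: "wrap n s k * s ^ (k div n) = s ^ (Suc k div n)"
  by (simp add: wrap_def div_Suc)

section \<open>Exponents in the cyclic group\<close>

locale even_cyclic_group = group G
  for G :: "('a, 'm) monoid_scheme" (structure) +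
  fixes a :: 'a and n :: nat
  assumes gen_closed [simp]: "a \<in> carrier G"
    and even_n: "even n" and n_pos: "0 < n"
    and carrier_eq: "carrier G = {a [^] r | r. r < n}"
    and order_eq: "order G = n"
begin

lemma n_ge_2: "2 \<le> n"
  using even_n n_pos by (auto elim!: evenE)

lemma gen_comm: "a \<otimes> a [^] k = a [^] k \<otimes> a" for k :: nat
  using nat_pow_Suc2[OF gen_closed, of k] by simp

lemma finite_carrier: "finite (carrier G)"
  unfolding carrier_eq by simp

text \<open>The \<open>n\<close> powers fill a carrier with \<open>n\<close> elements, so no two of
  them coincide.\<close>

lemma inj_pow: "inj_on (\<lambda>r. a [^] r) {..<n}"
proof (rule eq_card_imp_inj_on)
  have "(\<lambda>r. a [^] r) ` {..<n} = carrier G" unfolding carrier_eq by auto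
  then show "card ((\<lambda>r. a [^] r) ` {..<n}) = card {..<n}"
    using order_eq by (simp add: order_def)
qed simp

text \<open>Some \<open>r < n\<close> has \<open>a^n = a^r\<close>. Cancelling gives
  \<open>a^(n-r) = 1\<close>, which contradicts injectivity unless \<open>r = 0\<close>.\<close>

lemma pow_n: "a [^] n = \<one>"
proof -
  obtain r where r: "a [^] n = a [^] r" "r < n"
    using carrier_eq nat_pow_closed[OF gen_closed, of n] by blast
  have "a [^] (n - r) = a [^] (0::nat)"
    using pow_eq_div2[OF gen_closed r(1)] by simp
  then have "r = 0"
    using inj_onD[OF inj_pow, of "n - r" 0] r(2) by fastforce
  then show ?thesis using r(1) by simp
qed

lemma pow_mod: "a [^] (k mod n) = a [^] k"
proof -
  have "a [^] k = a [^] (n * (k div n) + k mod n)" by simp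
  also have "\<dots> = (a [^] n) [^] (k div n) \<otimes> a [^] (k mod n)"
    by (simp only: nat_pow_mult[OF gen_closed, symmetric] nat_pow_pow[OF gen_closed])
  finally show ?thesis by (simp add: pow_n)
qed

lemma carrier_powE:
  assumes "x \<in> carrier G"
  obtains k where "k < n" "x = a [^] k"
  using assms carrier_eq by blast

text \<open>The discrete logarithm to base \<open>a\<close>, normalised to lie below
  \<open>n\<close>.\<close>

definition ix :: "'a \<Rightarrow> nat" where
  "ix x = inv_into {..<n} (\<lambda>r. a [^] r) x"

lemma ix_pow: "ix (a [^] k) = k mod n"
proof -
  have "ix (a [^] (k mod n)) = k mod n"
    unfolding ix_def by (rule inv_into_f_f[OF inj_pow]) (simp add: n_pos)
  then show ?thesis by (simp add: pow_mod)
qed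

abbreviation sc :: "('a, 'w::real_vector) graded_algebra \<Rightarrow> ('a \<Rightarrow> 'w) \<Rightarrow> nat \<Rightarrow> nat \<Rightarrow> real" where
  "sc V v i k \<equiv> structure_constant G V v (a [^] i) (a [^] k)"

subsection \<open>Standard bases\<close>

lemma left_power_comp:
  assumes V: "graded_twisted_algebra G V" and w: "w \<in> comp V a" "w \<noteq> 0"
  shows "left_power V w k \<in> comp V (a [^] k) \<and> left_power V w k \<noteq> 0"
proof (induction k)
  case 0
  show ?case using graded_twisted_algebraD(4)[OF V] aone_nonzero[OF V gen_closed] by simp
next
  case (Suc k)
  have p: "a [^] k \<in> carrier G" by simp
  show ?case
    using graded_twisted_algebraD(8)[OF V gen_closed p w(1), of "left_power V w k"]
      graded_twisted_algebraD(9)[OF V gen_closed p w(1), of "left_power V w k"] w(2) Suc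
    by (simp add: gen_comm)
qed

lemma standard_basis_exists:
  fixes V :: "('a, 'w::real_vector) graded_algebra"
  assumes V: "graded_twisted_algebra G V"
  shows "\<exists>v. standard_basis G a V v"
proof -
  obtain w where w: "w \<in> comp V a" "w \<noteq> 0" using comp_nonzero[OF V gen_closed] by blast
  have "left_power V w n \<in> comp V \<one>" "left_power V w n \<noteq> 0"
    using left_power_comp[OF V w, of n] by (simp_all add: pow_n)
  then obtain \<alpha> where \<alpha>: "left_power V w n = \<alpha> *\<^sub>R aone V" "\<alpha> \<noteq> 0"
    using comp_multiple[OF V one_closed graded_twisted_algebraD(4)[OF V] aone_nonzero[OF V gen_closed],
      of "left_power V w n"] by auto
  \<comment> \<open>The case distinction makes the radicand positive, so that a real
    \<open>n\<close>-th root exists although \<open>n\<close> is even.\<close>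
  define \<beta> where "\<beta> = root n (if \<alpha> > 0 then 1 / \<alpha> else - (1 / \<alpha>))"
  have \<beta>: "\<beta> ^ n = (if \<alpha> > 0 then 1 / \<alpha> else - (1 / \<alpha>))"
    unfolding \<beta>_def using \<alpha>(2) n_pos by (intro real_root_pow_pos2) auto
  define v where "v x = \<beta> ^ ix x *\<^sub>R left_power V w (ix x)" for x
  have "left_power V w n = amult V w (left_power V w (n - 1))"
    using n_pos by (cases n) auto
  moreover have "v (a [^] k) = \<beta> ^ k *\<^sub>R left_power V w k" if "k < n" for k
    using that by (simp add: v_def ix_pow)
  moreover from this[of 0] have "v \<one> = aone V" using n_pos by simp
  ultimately have "standard_basis G a V v"
    unfolding standard_basis_def order_eq using w \<alpha> \<beta>
    by (intro exI[of _ w] exI[of _ \<alpha>] exI[of _ \<beta>]) simp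
  then show ?thesis by blast
qed

text \<open>Multiplying by \<open>v a\<close> shifts the basis by one degree without a factor,
  except at the step back to the identity. There the factor is a sign, by the normalisation of
  \<open>\<beta>\<close>.\<close>

lemma standard_basis_imp:
  fixes V :: "('a, 'w::real_vector) graded_algebra"
  assumes V: "graded_twisted_algebra G V" and v: "standard_basis G a V v"
  shows "graded_basis G V v"
    and "\<exists>s\<in>{1, -1}. \<forall>k. sc V v 1 k = wrap n s k"
proof -
  obtain w \<alpha> \<beta> where w: "w \<in> comp V a" "w \<noteq> 0" and \<alpha>: "\<alpha> \<noteq> 0"
      "amult V w (left_power V w (n - 1)) = \<alpha> *\<^sub>R aone V"
    and \<beta>: "\<beta> ^ n = (if \<alpha> > 0 then 1 / \<alpha> else - (1 / \<alpha>))"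
    and v1: "v \<one> = aone V"
    and vk: "\<And>k. 0 < k \<Longrightarrow> k < n \<Longrightarrow> v (a [^] k) = \<beta> ^ k *\<^sub>R left_power V w k"
    using v unfolding standard_basis_def order_eq by (elim exE conjE) blast
  have \<beta>0: "\<beta> \<noteq> 0" using \<alpha>(1) \<beta> n_pos by (auto simp: zero_power split: if_splits)
  have vk: "v (a [^] k) = \<beta> ^ k *\<^sub>R left_power V w k" if "k < n" for k
    using that vk[of k] v1 by (cases "k = 0") auto
  have va: "v a = \<beta> *\<^sub>R w"
    using vk[of 1] n_ge_2 by (simp add: graded_twisted_algebraD(3)[OF V])
  have gb: "v g \<in> comp V g \<and> v g \<noteq> 0" if g: "g \<in> carrier G" for g
  proof -
    obtain k where k: "k < n" "g = a [^] k" using g by (rule carrier_powE)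
    show ?thesis
      using left_power_comp[OF V w, of k] graded_twisted_algebraD(7)[OF V g] k vk[OF k(1)] \<beta>0
      by (simp add: subspace_scale)
  qed
  show b: "graded_basis G V v"
    by (rule graded_basisI[OF V finite_carrier]) (use gb v1 in auto)
  \<comment> \<open>The product of \<open>v a\<close> and \<open>v (a^(n-1))\<close> collects
    \<open>\<beta>\<close> and \<open>\<beta>^(n-1)\<close> from the scaling and
    \<open>\<alpha>\<close> from the left power.\<close>
  define s where "s = \<beta> ^ n * \<alpha>"
  have "s \<in> {1, -1}" using \<beta> \<alpha>(1) by (auto simp: s_def)
  moreover have "sc V v 1 k = wrap n s k" for k
  proof (rule structure_constant_eqI)
    \<comment> \<open>The claim concerns all \<open>k\<close>, but \<open>standard_basis\<close>
      describes the basis only for exponents below \<open>n\<close>.\<close>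
    define j where "j = k mod n"
    have j: "j < n" "a [^] k = a [^] j" using n_pos by (auto simp: j_def pow_mod)
    have wj: "wrap n s k = wrap n s j" by (simp add: wrap_def j_def mod_Suc)
    have "amult V (v a) (v (a [^] j)) = \<beta> ^ Suc j *\<^sub>R amult V w (left_power V w j)"
      using graded_twisted_algebraD(1)[OF V] by (simp add: va vk[OF j(1)] bilinear_lmul bilinear_rmul)
    also have "\<dots> = wrap n s j *\<^sub>R v (a [^] Suc j)"
    proof (cases "Suc j = n")
      case True
      then have "j = n - 1" "wrap n s j = s" by (auto simp: wrap_def)
      moreover have "v (a [^] Suc j) = aone V" using True v1 pow_n by metis
      ultimately show ?thesis using \<alpha>(2) True by (simp add: s_def del: nat_pow_Suc power_Suc)
    next
      case False
      then have "Suc j < n" using j by simp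
      then show ?thesis using vk[of "Suc j"] by (simp add: wrap_def)
    qed
    finally show "amult V (v (a [^] (1::nat))) (v (a [^] k)) = wrap n s k *\<^sub>R v (a [^] (1::nat) \<otimes> a [^] k)"
      using j(2) wj by (simp add: gen_comm)
    show "v (a [^] (1::nat) \<otimes> a [^] k) \<noteq> 0" by (rule graded_basisD(6)[OF b]) simp
  qed
  ultimately show "\<exists>s\<in>{1, -1}. \<forall>k. sc V v 1 k = wrap n s k" by blast
qed

text \<open>Names the sign intrinsically: it is the structure constant of
  \<open>(a, a^(n-1))\<close>, the one pair with first entry \<open>a\<close> at which the exponent
  wraps.\<close>

lemma standard_basis_sc_gen:
  fixes V :: "('a, 'w::real_vector) graded_algebra"
  assumes V: "graded_twisted_algebra G V" and v: "standard_basis G a V v"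
  shows "sc V v 1 (n - 1) \<in> {1, -1}" "sc V v 1 k = wrap n (sc V v 1 (n - 1)) k"
proof -
  obtain s where s: "s \<in> {1, -1}" "\<And>k. sc V v 1 k = wrap n s k"
    using standard_basis_imp(2)[OF V v] by blast
  moreover have "wrap n s (n - 1) = s" using n_pos by (simp add: wrap_def)
  ultimately show "sc V v 1 (n - 1) \<in> {1, -1}" "sc V v 1 k = wrap n (sc V v 1 (n - 1)) k"
    by simp_all
qed

text \<open>
  Symmetry of the associativity function at \<open>(a, a\<^sup>i, a\<^sup>k)\<close> is a recursion in \<open>k\<close> for the structure
  constants of the pairs \<open>(a\<^sup>i, a\<^sup>k)\<close>; going once around the group shows that they are signs.
\<close>

lemma standard_basis_sc:
  fixes V :: "('a, 'w::real_vector) graded_algebra"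
  assumes V: "graded_twisted_algebra G V" and sym: "symmetric_associativity G V"
    and v: "standard_basis G a V v" and i: "i < n"
  defines "s \<equiv> sc V v 1 (n - 1)"
  shows "sc V v i 1 \<in> {1, -1}"
    and "k < n \<Longrightarrow> sc V v i k = (sc V v i 1 * wrap n s i) ^ k * s ^ ((i + k) div n)"
proof -
  note b = standard_basis_imp(1)[OF V v]
  note s = standard_basis_sc_gen(1)[OF V v, folded s_def]
  note w = standard_basis_sc_gen(2)[OF V v, folded s_def]
  define f where "f = sc V v i 1"
  \<comment> \<open>In the symmetry equation the factor with first exponent \<open>Suc i\<close>
    occurs on both sides and cancels; each remaining \<open>wrap\<close> is its own inverse.\<close>
  have step: "sc V v i (Suc k) = sc V v i k * f * wrap n s (i + k) * wrap n s k * wrap n s i" for k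
  proof -
    have cl: "a [^] i \<in> carrier G" "a [^] k \<in> carrier G" "a [^] (1::nat) \<in> carrier G" by simp_all
    have m: "a [^] (1::nat) \<otimes> a [^] i = a [^] Suc i" "a [^] i \<otimes> a [^] (1::nat) = a [^] Suc i"
      "a [^] i \<otimes> a [^] k = a [^] (i + k)" "a [^] (1::nat) \<otimes> a [^] k = a [^] Suc k"
      by (simp_all add: nat_pow_mult gen_comm)
    have "associativity_function G V v (a [^] (1::nat)) (a [^] i) (a [^] k) =
        associativity_function G V v (a [^] i) (a [^] (1::nat)) (a [^] k)"
      using sym b cl unfolding symmetric_associativity_def by blast
    then have "sc V v i k * inverse (sc V v (Suc i) k) * wrap n s (i + k) * inverse (wrap n s i) =
        wrap n s k * inverse (sc V v (Suc i) k) * sc V v i (Suc k) * inverse f"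
      unfolding associativity_function_def m w f_def .
    moreover have "wrap n s i \<noteq> 0" using wrap_square[OF s, of n i] by auto
    moreover have "sc V v (Suc i) k \<noteq> 0" "f \<noteq> 0"
      unfolding f_def by (rule amult_graded_basis(2)[OF V b]; simp)+
    ultimately have "sc V v i k * wrap n s (i + k) * f = wrap n s k * sc V v i (Suc k) * wrap n s i"
      by (simp add: field_simps)
    then have "(wrap n s k * wrap n s k) * (wrap n s i * wrap n s i) * sc V v i (Suc k) =
        sc V v i k * f * wrap n s (i + k) * wrap n s k * wrap n s i"
      by (simp only: ac_simps)
    then show ?thesis using wrap_square[OF s] by simp
  qed
  \<comment> \<open>The last factor is \<open>1\<close> for \<open>k < n\<close>; it is kept so that
    the formula can be evaluated at \<open>k = n\<close> too.\<close>
  have rec: "sc V v i k = (f * wrap n s i) ^ k * s ^ ((i + k) div n) * s ^ (k div n)" for k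
  proof (induction k)
    case 0
    show ?case using structure_constant_one(1)[OF V b, of "a [^] i"] i by simp
  next
    case (Suc k)
    have "sc V v i (Suc k) = (f * wrap n s i) ^ Suc k * (wrap n s (i + k) * s ^ ((i + k) div n)) *
        (wrap n s k * s ^ (k div n))"
      unfolding step Suc by (simp add: ac_simps)
    then show ?case unfolding wrap_power by simp
  qed
  \<comment> \<open>At \<open>k = n\<close> the second argument is the identity again. Both powers
    of \<open>s\<close> then have exponent \<open>1\<close> and cancel, leaving
    \<open>(f * wrap n s i)^n = 1\<close>.\<close>
  have "sc V v i n = 1"
    using structure_constant_one(1)[OF V b, of "a [^] i"] by (simp add: pow_n)
  then have "(f * wrap n s i) ^ n * (s * s) = 1"
    using rec[of n] i n_pos by (simp add: ac_simps)
  then have "\<bar>f * wrap n s i\<bar> ^ n = 1" using s even_n by (auto simp: power_even_abs)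
  then have "\<bar>f * wrap n s i\<bar> = 1"
    using n_pos by (auto dest: power_eq_1_iff)
  then have "f \<in> {1, -1}" using wrap_sign[OF s, of n i] by (auto simp: abs_if split: if_splits)
  then show "sc V v i 1 \<in> {1, -1}" unfolding f_def .
  show "sc V v i k = (sc V v i 1 * wrap n s i) ^ k * s ^ ((i + k) div n)" if "k < n"
    using rec[of k] that by (simp add: f_def)
qed

lemma standard_basis_sc_sign:
  fixes V :: "('a, 'w::real_vector) graded_algebra"
  assumes "graded_twisted_algebra G V" "symmetric_associativity G V" "standard_basis G a V v"
    and "x \<in> carrier G" "y \<in> carrier G"
  shows "structure_constant G V v x y \<in> {1, -1}"
proof -
  obtain i k where ik: "i < n" "x = a [^] i" "k < n" "y = a [^] k"
    using assms(4,5) by (metis carrier_powE)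
  have s: "sc V v 1 (n - 1) \<in> {1, -1}" using standard_basis_sc_gen(1)[OF assms(1,3)] .
  have "sc V v i 1 * wrap n (sc V v 1 (n - 1)) i \<in> {1, -1}"
    using standard_basis_sc(1)[OF assms(1-3) ik(1)] wrap_sign[OF s, of n i] by auto
  from sign_power[OF this, of k] sign_power[OF s, of "(i + k) div n"] show ?thesis
    using standard_basis_sc(2)[OF assms(1-3) ik(1,3)] ik(2,4) by auto
qed

text \<open>The formula of \<open>standard_basis_sc\<close> involves only \<open>s\<close> and the
  constants \<open>C(a^i, a)\<close>. The latter are free only for \<open>i \<ge> 2\<close>: the
  identity settles \<open>i = 0\<close>, and \<open>i = 1\<close> is a value of \<open>wrap\<close>,
  determined by \<open>s\<close>.\<close>

lemma standard_basis_sc_eq: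
  fixes V :: "('a, 'w::real_vector) graded_algebra" and V' :: "('a, 'v::real_vector) graded_algebra"
  assumes V: "graded_twisted_algebra G V" "symmetric_associativity G V" "standard_basis G a V v"
    and V': "graded_twisted_algebra G V'" "symmetric_associativity G V'" "standard_basis G a V' v'"
    and s: "sc V v 1 (n - 1) = sc V' v' 1 (n - 1)"
    and f: "\<And>i. 2 \<le> i \<Longrightarrow> i < n \<Longrightarrow> sc V v i 1 = sc V' v' i 1"
    and xy: "x \<in> carrier G" "y \<in> carrier G"
  shows "structure_constant G V v x y = structure_constant G V' v' x y"
proof -
  obtain i k where ik: "i < n" "x = a [^] i" "k < n" "y = a [^] k"
    using xy by (metis carrier_powE)
  have "sc V v i 1 = sc V' v' i 1"
  proof -
    consider "i = 0" | "i = 1" | "2 \<le> i" by linarith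
    then show ?thesis
    proof cases
      case 1
      then show ?thesis
        using structure_constant_one(2)[OF V(1) standard_basis_imp(1)[OF V(1,3)] gen_closed]
          structure_constant_one(2)[OF V'(1) standard_basis_imp(1)[OF V'(1,3)] gen_closed] by simp
    next
      case 2
      show ?thesis
        unfolding 2 standard_basis_sc_gen(2)[OF V(1,3), of 1] standard_basis_sc_gen(2)[OF V'(1,3), of 1] s ..
    qed (use f ik in blast)
  qed
  then show ?thesis
    unfolding ik standard_basis_sc(2)[OF V ik(1,3)] standard_basis_sc(2)[OF V' ik(1,3)] s by simp
qed

lemma graded_isomorphicI_standard_basis:
  fixes V :: "('a, 'w::real_vector) graded_algebra" and V' :: "('a, 'v::real_vector) graded_algebra"
  assumes V: "graded_twisted_algebra G V" "symmetric_associativity G V" "standard_basis G a V v"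
    and V': "graded_twisted_algebra G V'" "symmetric_associativity G V'" "standard_basis G a V' v'"
    and s: "sc V v 1 (n - 1) = sc V' v' 1 (n - 1)"
    and f: "\<And>i. 2 \<le> i \<Longrightarrow> i < n \<Longrightarrow> sc V v i 1 = sc V' v' i 1"
  shows "graded_isomorphic G V V'"
  by (rule graded_isomorphicI_structure_constant[OF V(1) standard_basis_imp(1)[OF V(1,3)]
        V'(1) standard_basis_imp(1)[OF V'(1,3)] standard_basis_sc_eq[OF V V' s f]])

text \<open>An isomorphism multiplies the basis vector of degree \<open>a^k\<close> by
  \<open>\<mu>^k\<close> for \<open>k < n\<close>. Hence structure constants change by a power of
  \<open>\<mu>^n\<close>, and this is \<open>1\<close> once \<open>\<mu>\<close> is known to be a
  sign. The lemma also applies to two standard bases of one algebra.\<close>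

lemma graded_isomorphic_sc:
  fixes V :: "('a, 'w::real_vector) graded_algebra" and V' :: "('a, 'v::real_vector) graded_algebra"
  assumes V: "graded_twisted_algebra G V" "standard_basis G a V v"
    and V': "graded_twisted_algebra G V'" "standard_basis G a V' v'"
    and iso: "graded_isomorphic G V V'"
  shows "sc V v 1 (n - 1) = sc V' v' 1 (n - 1)" "i < n \<Longrightarrow> sc V v i 1 = sc V' v' i 1"
proof -
  obtain \<phi> where \<phi>: "linear \<phi>" "\<phi> (aone V) = aone V'"
      "\<And>u v. \<phi> (amult V u v) = amult V' (\<phi> u) (\<phi> v)"
    and \<phi>_comp: "\<forall>g\<in>carrier G. \<phi> ` comp V g \<subseteq> comp V' g"
    using iso unfolding graded_isomorphic_def by blast
  note b = standard_basis_imp(1)[OF V] and b' = standard_basis_imp(1)[OF V']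
  define s where "s = sc V v 1 (n - 1)"
  define s' where "s' = sc V' v' 1 (n - 1)"
  have s: "s \<in> {1, -1}" and s': "s' \<in> {1, -1}"
    unfolding s_def s'_def by (rule standard_basis_sc_gen(1)[OF V] standard_basis_sc_gen(1)[OF V'])+
  have mult: "amult V (v (a [^] i)) (v (a [^] k)) = sc V v i k *\<^sub>R v (a [^] (i + k))" for i k
    using amult_graded_basis(1)[OF V(1) b, of "a [^] i" "a [^] k"] by (simp add: nat_pow_mult)
  have mult': "amult V' (v' (a [^] i)) (v' (a [^] k)) = sc V' v' i k *\<^sub>R v' (a [^] (i + k))" for i k
    using amult_graded_basis(1)[OF V'(1) b', of "a [^] i" "a [^] k"] by (simp add: nat_pow_mult)
  have nz: "v' (a [^] k) \<noteq> 0" for k :: nat using graded_basisD(6)[OF b'] by simp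
  have "\<phi> (v a) \<in> comp V' a" using \<phi>_comp gen_closed graded_basisD(4)[OF b gen_closed] by blast
  then obtain \<mu> where \<mu>: "\<phi> (v a) = \<mu> *\<^sub>R v' a"
    using comp_multiple[OF V'(1) gen_closed graded_basisD(4,6)[OF b' gen_closed]] by blast
  have pow: "\<phi> (v (a [^] k)) = \<mu> ^ k *\<^sub>R v' (a [^] k)" if "k < n" for k
    using that
  proof (induction k)
    case 0
    show ?case using \<phi>(2) graded_basisD(5)[OF b] graded_basisD(5)[OF b'] by simp
  next
    case (Suc k)
    have "v (a [^] Suc k) = amult V (v a) (v (a [^] k))"
      using mult[of 1 k] standard_basis_sc_gen(2)[OF V, of k] Suc.prems by (simp add: wrap_def)
    moreover have "v' (a [^] Suc k) = amult V' (v' a) (v' (a [^] k))"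
      using mult'[of 1 k] standard_basis_sc_gen(2)[OF V', of k] Suc.prems by (simp add: wrap_def)
    ultimately show ?case
      using Suc graded_twisted_algebraD(1)[OF V'(1)]
      by (simp add: \<phi>(3) \<mu> bilinear_lmul bilinear_rmul del: nat_pow_Suc)
  qed
  \<comment> \<open>The image of a product is computed in two ways. The reduced exponent comes from
    applying \<open>pow\<close> to the product vector, the full exponent from applying it to each
    factor.\<close>
  have key: "sc V v i k * \<mu> ^ ((i + k) mod n) = \<mu> ^ (i + k) * sc V' v' i k" if "i < n" "k < n" for i k
  proof -
    have "\<phi> (amult V (v (a [^] i)) (v (a [^] k))) =
        (sc V v i k * \<mu> ^ ((i + k) mod n)) *\<^sub>R v' (a [^] (i + k))"
      using pow[of "(i + k) mod n"] n_pos \<phi>(1) by (simp add: mult linear_scale pow_mod)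
    moreover have "\<phi> (amult V (v (a [^] i)) (v (a [^] k))) =
        (\<mu> ^ (i + k) * sc V' v' i k) *\<^sub>R v' (a [^] (i + k))"
      using graded_twisted_algebraD(1)[OF V'(1)] that
      by (simp add: \<phi>(3) pow bilinear_lmul bilinear_rmul mult' power_add)
    ultimately show ?thesis using nz[of "i + k"] by simp
  qed
  \<comment> \<open>The wrapping pair \<open>(a, a^(n-1))\<close> isolates \<open>\<mu>^n\<close>;
    as \<open>s\<close> and \<open>s'\<close> are signs, \<open>\<mu>\<close> has absolute value
    \<open>1\<close>.\<close>
  have "s = \<mu> ^ n * s'" using key[of 1 "n - 1"] n_ge_2 by (simp add: s_def s'_def)
  then have "\<bar>\<mu>\<bar> ^ n = 1" using s s' by (auto simp flip: power_abs simp: abs_mult)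
  then have "\<bar>\<mu>\<bar> = 1" using n_pos by (auto dest: power_eq_1_iff)
  then have \<mu>_sign: "\<mu> \<in> {1, -1}" by (auto simp: abs_if split: if_splits)
  then have eq: "sc V v i k = sc V' v' i k" if "i < n" "k < n" for i k
    using key[OF that] sign_power_mod[OF \<mu>_sign even_n, of "i + k"] by auto
  show "sc V v 1 (n - 1) = sc V' v' 1 (n - 1)" "i < n \<Longrightarrow> sc V v i 1 = sc V' v' i 1"
    by (rule eq; use n_ge_2 in simp)+
qed

subsection \<open>Realisation of all sign patterns\<close>

text \<open>In the associativity function for \<open>c\<close>, the factor \<open>e_x^y\<close> from
  \<open>C(x, yz)\<close> cancels against \<open>C(x, y)\<close>. What remains,
  \<open>e_x^z e_y^z\<close> and powers of \<open>s\<close> depending on sums of exponents, is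
  symmetric in \<open>x\<close> and \<open>y\<close>. The condition \<open>e 1 = 1\<close> makes
  \<open>b\<close> itself a standard basis.\<close>

lemma realisation:
  fixes W :: "('a, 'w::real_vector) graded_algebra"
  assumes W: "graded_twisted_algebra G W" and b: "graded_basis G W b"
    and s: "s \<in> {1, -1}" and e: "\<And>i. e i \<in> {1, -1::real}" "e 0 = 1" "e 1 = 1"
  obtains V :: "('a, 'w) graded_algebra" where
    "graded_twisted_algebra G V" "symmetric_associativity G V" "standard_basis G a V b"
    "\<forall>i<n. \<forall>k<n. sc V b i k = e i ^ k * s ^ ((i + k) div n)"
proof -
  define c where "c x y = e (ix x) ^ ix y * s ^ ((ix x + ix y) div n)" for x y
  have sg: "e i \<noteq> 0" "s \<noteq> 0" for i using e(1)[of i] s by auto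
  have ix_less: "ix x < n" if "x \<in> carrier G" for x
    using that n_pos by (auto simp: ix_pow elim!: carrier_powE)
  have ix_one: "ix \<one> = 0" using ix_pow[of 0] by simp
  obtain V :: "('a, 'w) graded_algebra" where V: "graded_twisted_algebra G V" "graded_basis G V b"
    and Vc: "\<And>x y. x \<in> carrier G \<Longrightarrow> y \<in> carrier G \<Longrightarrow> structure_constant G V b x y = c x y"
    by (rule twisted_algebra_exists[OF finite_carrier W b, of c])
       (auto simp: c_def sg ix_less ix_one e(2))
  have ix_mult: "ix (x \<otimes> y) = (ix x + ix y) mod n" if "x \<in> carrier G" "y \<in> carrier G" for x y
    using that by (auto simp: ix_pow nat_pow_mult elim!: carrier_powE)
  \<comment> \<open>Evenness of \<open>n\<close> removes the reduction in the exponent of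
    \<open>e (ix x)\<close>, and additivity of carries merges the two powers of
    \<open>s\<close>.\<close>
  have cc: "c y z * c x (y \<otimes> z) = e (ix y) ^ ix z * e (ix x) ^ (ix y + ix z) *
      s ^ ((ix x + (ix y + ix z)) div n)"
    if "x \<in> carrier G" "y \<in> carrier G" "z \<in> carrier G" for x y z
    unfolding c_def ix_mult[OF that(2,3)] div_add_mod_div[symmetric, where k = "ix y + ix z"] power_add
      sign_power_mod[OF e(1) even_n] by (simp add: power_add)
  have sym: "symmetric_associativity G V"
  proof (rule symmetric_associativityI[OF V])
    fix x y z assume xyz: "x \<in> carrier G" "y \<in> carrier G" "z \<in> carrier G"
    have comm: "y \<otimes> x = x \<otimes> y"
      using xyz by (auto simp: nat_pow_mult add.commute elim!: carrier_powE)
    have "c y z * c x (y \<otimes> z) * inverse (c x y) = c x z * c y (x \<otimes> z) * inverse (c y x)"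
      unfolding cc[OF xyz] cc[OF xyz(2,1,3)]
      by (simp add: c_def field_simps sg power_add add.commute add.left_commute)
    then show "associativity_function G V b x y z = associativity_function G V b y x z"
      unfolding associativity_function_def using xyz by (simp add: Vc comm mult.commute mult.left_commute)
  qed
  have sc: "sc V b i k = e i ^ k * s ^ ((i + k) div n)" if "i < n" "k < n" for i k
    using that by (simp add: Vc c_def ix_pow)
  have mult: "amult V (b a) (b (a [^] k)) = s ^ (Suc k div n) *\<^sub>R b (a [^] Suc k)" if "k < n" for k
    using amult_graded_basis(1)[OF V, of a "a [^] k"] sc[of 1 k] that n_ge_2 e(3)
    by (simp add: gen_comm)
  have lp: "left_power V (b a) k = b (a [^] k)" if "k < n" for k
    using that
  proof (induction k)
    case 0
    show ?case using graded_basisD(5)[OF V(2)] by simp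
  next
    case (Suc k)
    then show ?case using mult[of k] by (simp del: nat_pow_Suc)
  qed
  have "amult V (b a) (left_power V (b a) (n - 1)) = s *\<^sub>R aone V"
    using mult[of "n - 1"] lp[of "n - 1"] n_pos pow_n graded_basisD(5)[OF V(2)]
    by (simp del: nat_pow_Suc)
  \<comment> \<open>The witnesses are \<open>w = b a\<close>, \<open>\<alpha> = s\<close> and
    \<open>\<beta> = 1\<close>; since \<open>s\<close> is a sign, \<open>1\<close> is the required
    value of \<open>\<beta>^n\<close> in both cases.\<close>
  then have "standard_basis G a V b"
    unfolding standard_basis_def order_eq using s sg(2) graded_basisD(4,6)[OF V(2) gen_closed] lp
      graded_basisD(5)[OF V(2)]
    by (intro exI[of _ "b a"] exI[of _ s] exI[of _ 1]) auto
  then show ?thesis using that[OF V(1) sym] sc by blast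
qed

section \<open>A complete invariant of graded isomorphism\<close>

text \<open>Exactly the free parameters of the classification. Restricting the function to
  \<open>{2..<n}\<close> makes signatures elements of an extensional function space, which can be
  counted.\<close>

definition signature :: "('a, 'w::real_vector) graded_algebra \<Rightarrow> real \<times> (nat \<Rightarrow> real)" where
  "signature V = (let v = SOME v. standard_basis G a V v in (sc V v 1 (n - 1), \<lambda>i\<in>{2..<n}. sc V v i 1))"

lemma graded_isomorphic_refl: "graded_isomorphic G V V"
  unfolding graded_isomorphic_def by (rule exI[of _ id]) (auto simp: linear_id)

text \<open>The identity map is an isomorphism, so the chosen standard basis and \<open>v\<close>
  have the same structure constants.\<close>

lemma signature_eq:
  fixes V :: "('a, 'w::real_vector) graded_algebra"
  assumes V: "graded_twisted_algebra G V" and v: "standard_basis G a V v"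
  shows "signature V = (sc V v 1 (n - 1), \<lambda>i\<in>{2..<n}. sc V v i 1)"
proof -
  define u where "u = (SOME v. standard_basis G a V v)"
  have u: "standard_basis G a V u" unfolding u_def by (rule someI[of _ v]) (rule v)
  note eq = graded_isomorphic_sc[OF V u V v graded_isomorphic_refl]
  have "(\<lambda>i\<in>{2..<n}. sc V u i 1) = (\<lambda>i\<in>{2..<n}. sc V v i 1)"
    by (rule restrict_ext) (use eq(2) in simp)
  then show ?thesis unfolding signature_def Let_def u_def[symmetric] eq(1) by simp
qed

text \<open>Signatures do not mention the underlying vector space, so algebras over different types
  can be compared.\<close>

lemma graded_isomorphic_iff_signature:
  fixes V :: "('a, 'w::real_vector) graded_algebra" and V' :: "('a, 'v::real_vector) graded_algebra"
  assumes V: "graded_twisted_algebra G V" "symmetric_associativity G V"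
    and V': "graded_twisted_algebra G V'" "symmetric_associativity G V'"
  shows "graded_isomorphic G V V' \<longleftrightarrow> signature V = signature V'"
proof -
  obtain v v' where v: "standard_basis G a V v" and v': "standard_basis G a V' v'"
    using standard_basis_exists[OF V(1)] standard_basis_exists[OF V'(1)] by blast
  note sig = signature_eq[OF V(1) v] signature_eq[OF V'(1) v']
  show ?thesis
  proof
    assume iso: "graded_isomorphic G V V'"
    note eq = graded_isomorphic_sc[OF V(1) v V'(1) v' iso]
    have "(\<lambda>i\<in>{2..<n}. sc V v i 1) = (\<lambda>i\<in>{2..<n}. sc V' v' i 1)"
      by (rule restrict_ext) (use eq(2) in simp)
    then show "signature V = signature V'" unfolding sig eq(1) by simp
  next
    assume "signature V = signature V'"
    then have s: "sc V v 1 (n - 1) = sc V' v' 1 (n - 1)"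
      and f: "(\<lambda>i\<in>{2..<n}. sc V v i 1) = (\<lambda>i\<in>{2..<n}. sc V' v' i 1)"
      unfolding sig by blast+
    have "sc V v i 1 = sc V' v' i 1" if "2 \<le> i" "i < n" for i
      using fun_cong[OF f, of i] that by simp
    with s show "graded_isomorphic G V V'"
      by (rule graded_isomorphicI_standard_basis[OF V v V' v'])
  qed
qed

lemma signature_mem:
  fixes V :: "('a, 'w::real_vector) graded_algebra"
  assumes V: "graded_twisted_algebra G V" "symmetric_associativity G V"
  shows "signature V \<in> {1, -1} \<times> ({2..<n} \<rightarrow>\<^sub>E {1, -1})"
proof -
  obtain v where v: "standard_basis G a V v" using standard_basis_exists[OF V(1)] ..
  show ?thesis
    unfolding signature_eq[OF V(1) v]
    using standard_basis_sc_gen(1)[OF V(1) v] standard_basis_sc(1)[OF V v] by auto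
qed

lemma signature_realised:
  fixes W :: "('a, 'w::real_vector) graded_algebra"
  assumes W: "graded_twisted_algebra G W"
    and p: "p \<in> {1, -1} \<times> ({2..<n} \<rightarrow>\<^sub>E {1, -1})"
  obtains V :: "('a, 'w) graded_algebra" where "graded_twisted_algebra G V"
    "symmetric_associativity G V" "signature V = p"
proof -
  obtain b where b: "standard_basis G a W b" using standard_basis_exists[OF W] ..
  obtain s f where sf: "p = (s, f)" "s \<in> {1, -1}" "f \<in> {2..<n} \<rightarrow>\<^sub>E {1, -1}"
    using p by blast
  \<comment> \<open>The realised constant of \<open>(a^i, a)\<close> is
    \<open>e i * s ^ (Suc i div n)\<close>. The factor \<open>wrap\<close> undoes the extra
    \<open>s\<close> that occurs at \<open>i = n - 1\<close>.\<close>
  define e where "e i = (if i \<in> {2..<n} then f i * wrap n s i else 1)" for i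
  have e: "e i \<in> {1, -1}" for i
    using sf(3) wrap_sign[OF sf(2), of n i] by (auto simp: e_def dest: PiE_mem)
  have e01: "e 0 = 1" "e 1 = 1" by (simp_all add: e_def)
  obtain V :: "('a, 'w) graded_algebra" where V: "graded_twisted_algebra G V"
    "symmetric_associativity G V" "standard_basis G a V b"
    "\<forall>i<n. \<forall>k<n. sc V b i k = e i ^ k * s ^ ((i + k) div n)"
    by (rule realisation[where e = e, OF W standard_basis_imp(1)[OF W b] sf(2) e e01])
  have "sc V b 1 (n - 1) = s"
    using V(4)[rule_format, of 1 "n - 1"] n_ge_2 by (simp add: e_def)
  moreover have "(\<lambda>i\<in>{2..<n}. sc V b i 1) = f"
  proof (rule extensionalityI[of _ "{2..<n}"])
    fix i assume i: "i \<in> {2..<n}"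
    have "sc V b i 1 = f i * wrap n s i * s ^ (Suc i div n)"
      using V(4)[rule_format, of i 1] i n_ge_2 by (simp add: e_def)
    also have "\<dots> = f i * (wrap n s i * wrap n s i)"
      using wrap_power[of n s i] i by simp
    finally show "(\<lambda>i\<in>{2..<n}. sc V b i 1) i = f i"
      using i wrap_square[OF sf(2)] by simp
  qed (use sf(3) in \<open>auto simp: PiE_def\<close>)
  ultimately show ?thesis
    using that V signature_eq[OF V(1,3)] sf(1) by blast
qed

lemma card_signatures: "card ({1, -1::real} \<times> ({2..<n} \<rightarrow>\<^sub>E {1, -1::real})) = 2 * 2 ^ (n - 2)"
  by (simp add: card_cartesian_product card_PiE numeral_2_eq_2)

end

section \<open>Counting classes, and the group of values\<close>

text \<open>The classes are the nonempty fibres of \<open>f\<close>, one for each value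
  attained.\<close>

lemma card_quotient_eq_card_image:
  assumes "\<And>x y. (x, y) \<in> r \<longleftrightarrow> x \<in> S \<and> y \<in> S \<and> f x = f y"
  shows "card (S // r) = card (f ` S)"
proof -
  have "r `` {x} = {y \<in> S. f y = f x}" if "x \<in> S" for x
    using assms that by auto
  then have "S // r = (\<lambda>c. {y \<in> S. f y = c}) ` f ` S"
    unfolding quotient_def by auto
  moreover have "inj_on (\<lambda>c. {y \<in> S. f y = c}) (f ` S)"
    by (rule inj_onI) blast
  ultimately show ?thesis by (simp add: card_image)
qed

lemma generate_real_units_signs:
  assumes "S \<subseteq> {1, -1}" "-1 \<in> S"
  shows "generate real_units S = {1, -1}"
proof
  have u: "group real_units"
  proof (rule groupI)
    fix x assume "x \<in> carrier real_units"
    then show "\<exists>y\<in>carrier real_units. y \<otimes>\<^bsub>real_units\<^esub> x = \<one>\<^bsub>real_units\<^esub>"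
      by (intro bexI[of _ "inverse x"]) (auto simp: real_units_def)
  qed (auto simp: real_units_def)
  have inv_sign: "inv\<^bsub>real_units\<^esub> x = x" if "x \<in> {1, -1}" for x
    by (rule group.inv_equality[OF u]) (use that in \<open>auto simp: real_units_def\<close>)
  show "generate real_units S \<subseteq> {1, -1}"
  proof
    fix x assume "x \<in> generate real_units S"
    then show "x \<in> {1, -1}"
    proof induction
      case (inv h)
      then show ?case using assms(1) inv_sign by auto
    qed (use assms(1) in \<open>auto simp: real_units_def\<close>)
  qed
  show "{1, -1} \<subseteq> generate real_units S"
    using generate.one[of real_units S] generate.incl[OF assms(2)] by (simp add: real_units_def)
qed

theorem theorem8:
  fixes G :: "('g, 'm) monoid_scheme" (structure)
    and a :: 'g
    and m :: nat
    and W :: "('g, 'w::real_vector) graded_algebra"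
    and B :: "'g \<Rightarrow> 'w"
    and A :: "real set"
    and \<A> :: "('g, 'w) graded_algebra set"
  assumes "group G"
    and "m > 0"
    and "a \<in> carrier G"
    and "carrier G = {a [^] r | r. r < 2 * m}"
    and "order G = 2 * m"
    and "graded_twisted_algebra G W"
    and "symmetric_associativity G W"
    and "standard_basis G a W B"
    and "\<A> = {V. graded_twisted_algebra G V \<and> symmetric_associativity G V}"
    and "A = structure_constant_group G a \<A>"
  shows "(\<forall>(W' :: ('g, 'v::real_vector) graded_algebra) B'.
            graded_twisted_algebra G W' \<longrightarrow> symmetric_associativity G W' \<longrightarrow>
            standard_basis G a W' B' \<longrightarrow>
            structure_constant G W' B' a (a [^] (2 * m - 1)) =
              structure_constant G W B a (a [^] (2 * m - 1)) \<longrightarrow>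
            (\<forall>r < 2 * m. structure_constant G W' B' (a [^] r) a =
                            structure_constant G W B (a [^] r) a) \<longrightarrow>
            (\<forall>x\<in>carrier G. \<forall>y\<in>carrier G.
                structure_constant G W' B' x y = structure_constant G W B x y) \<and>
            graded_isomorphic G W W') \<and>
         (\<forall>W' :: ('g, 'v) graded_algebra.
            graded_twisted_algebra G W' \<longrightarrow> symmetric_associativity G W' \<longrightarrow>
            (\<exists>V\<in>\<A>. graded_isomorphic G V W')) \<and>
         finite A \<and>
         card (\<A> // graded_iso_rel G \<A>) = 2 * card A ^ (2 * m - 2)"
proof -
  interpret even_cyclic_group G a "2 * m"
    using assms(1-5) by (simp add: even_cyclic_group_def even_cyclic_group_axioms_def)
  let ?sig = "{1, -1::real} \<times> ({2..<2 * m} \<rightarrow>\<^sub>E {1, -1::real})"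
  note W = assms(6-8) and \<A> = assms(9)
  have determined: "(\<forall>x\<in>carrier G. \<forall>y\<in>carrier G.
        structure_constant G W' B' x y = structure_constant G W B x y) \<and> graded_isomorphic G W W'"
    if W': "graded_twisted_algebra G W'" "symmetric_associativity G W'" "standard_basis G a W' B'"
      and s: "structure_constant G W' B' a (a [^] (2 * m - 1)) =
        structure_constant G W B a (a [^] (2 * m - 1))"
      and f: "\<forall>r < 2 * m. structure_constant G W' B' (a [^] r) a = structure_constant G W B (a [^] r) a"
    for W' :: "('g, 'v) graded_algebra" and B'
  proof -
    have s': "sc W B 1 (2 * m - 1) = sc W' B' 1 (2 * m - 1)" using s by simp
    have f': "sc W B i 1 = sc W' B' i 1" if "2 \<le> i" "i < 2 * m" for i
      using f that(2) by simp
    show ?thesis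
      using standard_basis_sc_eq[OF W W' s' f'] graded_isomorphicI_standard_basis[OF W W' s' f']
      by simp
  qed
  have represented: "\<exists>V\<in>\<A>. graded_isomorphic G V W'"
    if W': "graded_twisted_algebra G W'" "symmetric_associativity G W'"
    for W' :: "('g, 'v) graded_algebra"
  proof -
    \<comment> \<open>The signature of \<open>W'\<close> is realised on the vector space of
      \<open>W\<close>, which gives a representative in \<open>\<A>\<close>.\<close>
    obtain V :: "('g, 'w) graded_algebra" where V: "graded_twisted_algebra G V"
      "symmetric_associativity G V" "signature V = signature W'"
      by (rule signature_realised[OF W(1) signature_mem[OF W']])
    then show ?thesis
      using graded_isomorphic_iff_signature[OF V(1,2) W'] unfolding \<A> by blast
  qed
  have "A = {1, -1}"
    unfolding assms(10) structure_constant_group_def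
  proof (rule generate_real_units_signs)
    show "{structure_constant G V v x y | V v x y.
       V \<in> \<A> \<and> standard_basis G a V v \<and> x \<in> carrier G \<and> y \<in> carrier G} \<subseteq> {1, -1}"
      unfolding \<A> mem_Collect_eq by (intro subsetI) (elim CollectE exE conjE, simp only: standard_basis_sc_sign)
    \<comment> \<open>An algebra with \<open>s = -1\<close> shows that the value \<open>-1\<close>
      is attained, so that \<open>A\<close> has two elements.\<close>
    obtain V :: "('g, 'w) graded_algebra" where V: "graded_twisted_algebra G V"
      "symmetric_associativity G V" "signature V = (-1, \<lambda>i\<in>{2..<2 * m}. 1)"
      by (rule signature_realised[OF W(1), of "(-1, \<lambda>i\<in>{2..<2 * m}. 1)"]) auto
    obtain v where v: "standard_basis G a V v"
      using standard_basis_exists[OF V(1)] by blast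
    have "sc V v 1 (2 * m - 1) = -1"
      using signature_eq[OF V(1) v] V(3) by simp
    then show "-1 \<in> {structure_constant G V v x y | V v x y.
       V \<in> \<A> \<and> standard_basis G a V v \<and> x \<in> carrier G \<and> y \<in> carrier G}"
      using V(1,2) v nat_pow_closed[OF gen_closed] unfolding \<A> mem_Collect_eq
      by (intro exI[of _ V] exI[of _ v] exI[of _ "a [^] (1::nat)"] exI[of _ "a [^] (2 * m - 1)"]) metis
  qed
  moreover have "card (\<A> // graded_iso_rel G \<A>) = card (signature ` \<A>)"
    by (rule card_quotient_eq_card_image)
      (use graded_isomorphic_iff_signature in \<open>auto simp: graded_iso_rel_def \<A>\<close>)
  moreover have "signature ` \<A> = ?sig"
  proof
    show "signature ` \<A> \<subseteq> ?sig"
      unfolding \<A> by (rule image_subsetI) (simp only: mem_Collect_eq signature_mem)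
    show "?sig \<subseteq> signature ` \<A>"
    proof
      fix p assume "p \<in> ?sig"
      then obtain V :: "('g, 'w) graded_algebra" where "graded_twisted_algebra G V"
        "symmetric_associativity G V" "signature V = p"
        by (rule signature_realised[OF W(1)])
      then show "p \<in> signature ` \<A>" unfolding \<A> by blast
    qed
  qed
  ultimately have "finite A" "card (\<A> // graded_iso_rel G \<A>) = 2 * card A ^ (2 * m - 2)"
    using card_signatures by (simp_all add: numeral_2_eq_2)
  then show ?thesis
    using determined represented by blast
qed

end
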